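(* Let $S\in\mathbb{R}^{n\times n}$ be a graph shift operator with eigendecomposition $S=V\Lambda V^\top$, $V=[v_1,\dots,v_n]$ orthogonal. Let $\Phi^{(0)},\dots,\Phi^{(K)}$ be the parameter matrices of an eigenvector-sharing edge varying graph filter (ES-EdgeGF), i.e. there is a common orthogonal matrix $U=[u_1,\dots,u_n]$ (not necessarily equal to $V$) such that for each $k$, $\Phi^{(k)}=U\,\mathrm{diag}(\phi^{(k)}_1,\dots,\phi^{(k)}_n)\,U^\top$ for some real numbers $\phi_i^{(k)}$, and $[\Phi^{(k)}]_{ij}=0$ whenever $[S+I]_{ij}=0$. For a matrix $M\in\mathbb{R}^{n\times n}$ and $x\in\mathbb{R}^n$ put $$H_{\rm ES}(x,M)=\sum_{k=0}^K\Phi^{(k)}M^kx .$$ Let $h_i(\lambda)=\sum_{k=0}^K\phi_i^{(k)}\lambda^k$, $i=1,\dots,n$, be the eigenvector-sharing filter frequency response. Assume that it is integral Lipschitz with respect to $C_L>0$, i.e. for any $\lambda_1\neq\lambda_2$ and $i=1,\dots,n$, $$\Big|\frac{\lambda_1+\lambda_2}{2}\cdot\frac{h_i(\lambda_1)-h_i(\lambda_2)}{\lambda_1-\lambda_2}\Big|\le C_L ,$$ and that $|h_i(\lambda)|\le 1$ for $i=1,\dots,n$. Assume that $V$ and $U$ are $\varepsilon$-misaligned. Let $\widetilde S=S+ES+SE$, with $E\in\mathbb{R}^{n\times n}$ symmetric, be a relative perturbation of $S$ of size $\epsilon$, i.e. $\|E\|_2\le\epsilon$. Then for any $x\in\mathbb{R}^n$,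 $$\|H_{\rm ES}(x,S)-H_{\rm ES}(x,\widetilde S)\|_2\le C_{\rm ES}\,\|x\|_2\,\epsilon+\mathcal{O}(\epsilon^2),\qquad C_{\rm ES}=2\sqrt n\,(1+n\varepsilon)\,C_L .$$
   Context: A graph has nodes $\{1,\dots,n\}$ and edge set $\mathcal{E}$; a graph shift operator is a real symmetric matrix $S\in\mathbb{R}^{n\times n}$ whose sparsity follows the graph: $[S]_{ij}\ne0$ iff $(i,j)\in\mathcal{E}$ or $i=j$. A graph signal is a vector $x\in\mathbb{R}^n$. $\|\cdot\|_2$ is the Euclidean norm on vectors and the spectral (operator) norm on matrices. $\varepsilon$-misalignment: for orthonormal eigenvector bases $V=[v_1,\dots,v_n]$ and $U=[u_1,\dots,u_n]$, write $v_i=\sum_{j=1}^n\hat v_{ij}u_j$ and $u_j=\sum_{i=1}^n\hat u_{ji}v_i$. $V$ and $U$ are $\varepsilon$-misaligned if $|\hat u_{ij}|\le\varepsilon$ and $|\hat v_{ij}|\le\varepsilon$ for all $i\ne j$. Two different small parameters appear: $\epsilon$ is the perturbation size and $\varepsilon$ is the misalignment. The filter on the perturbed graph, $H_{\rm ES}(x,\widetilde S)$, uses the same matrices $\Phi^{(k)}$, with only the powers of $S$ replaced by powers of $\widetilde S$. $\mathcal{O}(\epsilon^2)$ denotes a quantity bounded in absolute value by $M\epsilon^2$ for all sufficiently small $\epsilon$, where $M$ may depend on $n$, $K$, $S$, the eigenvalues $\phi_i^{(k)}$ and $x$, but not on $E$. *)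

theory Defs
  imports "HOL-Analysis.Analysis"
begin

text \<open>The graph has vertex set \<open>UNIV :: 'n set\<close>, so the number of nodes is \<open>CARD('n)\<close>.\<close>

definition graph_shift_operator :: "('n \<times> 'n) set \<Rightarrow> real^'n^'n \<Rightarrow> bool" where
  "graph_shift_operator \<E> S \<longleftrightarrow>
     transpose S = S \<and> (\<forall>i j. S $ i $ j \<noteq> 0 \<longleftrightarrow> (i, j) \<in> \<E> \<or> i = j)"

definition diag_matrix :: "('n \<Rightarrow> real) \<Rightarrow> real^'n^'n" where
  "diag_matrix d = (\<chi> i j. if i = j then d i else 0)"

text \<open>The library's \<open>*\<close> and \<open>^\<close> on \<open>real^'n^'n\<close> act componentwise, and its \<open>norm\<close> is the
  Frobenius norm; the matrix power and the spectral norm therefore need their own names.\<close>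

primrec matrix_power :: "real^'n^'n \<Rightarrow> nat \<Rightarrow> real^'n^'n" where
  "matrix_power A 0 = mat 1"
| "matrix_power A (Suc k) = A ** matrix_power A k"

definition spectral_norm :: "real^'n^'n \<Rightarrow> real" where
  "spectral_norm A = onorm ((*v) A)"

definition eigendecomposition :: "real^'n^'n \<Rightarrow> real^'n^'n \<Rightarrow> ('n \<Rightarrow> real) \<Rightarrow> bool" where
  "eigendecomposition A V d \<longleftrightarrow>
     orthogonal_matrix V \<and> A = V ** diag_matrix d ** transpose V"

definition es_edge_parameters ::
    "real^'n^'n \<Rightarrow> nat \<Rightarrow> real^'n^'n \<Rightarrow> (nat \<Rightarrow> 'n \<Rightarrow> real) \<Rightarrow> (nat \<Rightarrow> real^'n^'n) \<Rightarrow> bool" where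
  "es_edge_parameters S K U \<phi> \<Phi> \<longleftrightarrow>
     (\<forall>k\<le>K. eigendecomposition (\<Phi> k) U (\<phi> k) \<and>
            (\<forall>i j. (S + mat 1) $ i $ j = 0 \<longrightarrow> \<Phi> k $ i $ j = 0))"

definition es_filter :: "nat \<Rightarrow> (nat \<Rightarrow> real^'n^'n) \<Rightarrow> real^'n \<Rightarrow> real^'n^'n \<Rightarrow> real^'n" where
  "es_filter K \<Phi> x M = (\<Sum>k\<le>K. (\<Phi> k ** matrix_power M k) *v x)"

definition es_response :: "nat \<Rightarrow> (nat \<Rightarrow> 'n \<Rightarrow> real) \<Rightarrow> 'n \<Rightarrow> real \<Rightarrow> real" where
  "es_response K \<phi> i \<mu> = (\<Sum>k\<le>K. \<phi> k i * \<mu> ^ k)"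

definition integral_lipschitz_on :: "real set \<Rightarrow> real \<Rightarrow> (real \<Rightarrow> real) \<Rightarrow> bool" where
  "integral_lipschitz_on D C h \<longleftrightarrow>
     (\<forall>\<mu>\<^sub>1\<in>D. \<forall>\<mu>\<^sub>2\<in>D. \<mu>\<^sub>1 \<noteq> \<mu>\<^sub>2 \<longrightarrow>
        \<bar>(\<mu>\<^sub>1 + \<mu>\<^sub>2) / 2 * ((h \<mu>\<^sub>1 - h \<mu>\<^sub>2) / (\<mu>\<^sub>1 - \<mu>\<^sub>2))\<bar> \<le> C)"

text \<open>A set of frequencies on which the conditions on the responses are imposed: an interval,
  bounded or not, containing the eigenvalues. Taking \<open>D = UNIV\<close> imposes them for all reals, but
  that forces the polynomials to be constant; smaller intervals allow nonconstant responses.\<close>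

definition frequency_domain :: "real set \<Rightarrow> ('n \<Rightarrow> real) \<Rightarrow> bool" where
  "frequency_domain D d \<longleftrightarrow> is_interval D \<and> interior D \<noteq> {} \<and> range d \<subseteq> D"

text \<open>For orthogonal \<open>V\<close> and \<open>U\<close> the coefficients \<open>vh\<close> and \<open>uh\<close> of the expansions exist and are
  unique, so the existential quantifier merely names them.\<close>

definition misaligned :: "real \<Rightarrow> real^'n^'n \<Rightarrow> real^'n^'n \<Rightarrow> bool" where
  "misaligned \<epsilon> V U \<longleftrightarrow>
     (\<exists>vh uh :: 'n \<Rightarrow> 'n \<Rightarrow> real.
        (\<forall>i. column i V = (\<Sum>j\<in>UNIV. vh i j *\<^sub>R column j U)) \<and>
        (\<forall>j. column j U = (\<Sum>i\<in>UNIV. uh j i *\<^sub>R column i V)) \<and>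
        (\<forall>i j. i \<noteq> j \<longrightarrow> \<bar>uh i j\<bar> \<le> \<epsilon> \<and> \<bar>vh i j\<bar> \<le> \<epsilon>))"

definition relative_perturbation :: "real^'n^'n \<Rightarrow> real^'n^'n \<Rightarrow> real^'n^'n" where
  "relative_perturbation S E = S + E ** S + S ** E"

end

theory Submission
  imports Defs
begin

text \<open>To first order in \<open>E\<close> the filter changes by the derivative of the matrix powers in the direction
  \<open>E S + S E\<close>. Its coordinate along \<open>u\<^sub>l\<close> is
  \<open>\<Sum>\<^sub>i\<^sub>j (x \<bullet> v\<^sub>i) (v\<^sub>j \<bullet> E v\<^sub>i) (v\<^sub>j \<bullet> u\<^sub>l) g\<^sub>l(\<lambda>\<^sub>i, \<lambda>\<^sub>j)\<close> with
  \<open>g\<^sub>l(a, b) = (a + b) (h\<^sub>l(a) - h\<^sub>l(b)) / (a - b)\<close>, and the integral Lipschitz condition bounds \<open>g\<^sub>l\<close> by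
  \<open>2 C\<^sub>L\<close> (for \<open>a = b\<close> by continuity). Cauchy--Schwarz on the row \<open>(v\<^sub>j \<bullet> E v\<^sub>i)\<^sub>i\<close>, whose norm is
  \<open>\<parallel>E v\<^sub>j\<parallel>\<close>, bounds the sum over \<open>i\<close>; misalignment bounds \<open>\<Sum>\<^sub>j \<bar>v\<^sub>j \<bullet> u\<^sub>l\<bar>\<close> by \<open>1 + n \<epsilon>\<close>; and
  passing from coordinates to the Euclidean norm costs the factor \<open>\<surd>n\<close>.\<close>

section \<open>Orthogonal matrices and eigendecompositions\<close>

text \<open>As a simp rule this would rewrite \<open>transpose V *v x\<close>, the vector of
  coordinates of \<open>x\<close> in the basis of columns of \<open>V\<close>, into
  \<open>x v* V\<close>; the coordinate form has to survive simplification.\<close>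

declare transpose_matrix_vector [simp del]

lemma transpose_mult_vec_nth: "(transpose V *v x) $ i = column i V \<bullet> x"
  for V :: "real^'n^'n"
  by (simp add: matrix_vector_mult_def transpose_def column_def inner_vec_def)

lemma inner_transpose_orthogonal:
  fixes V :: "real^'n^'n"
  assumes "orthogonal_matrix V"
  shows "(transpose V *v x) \<bullet> (transpose V *v y) = x \<bullet> y"
  using assms
  by (metis dot_lmul_matrix matrix_vector_mul_assoc matrix_vector_mul_lid orthogonal_matrix_def
      transpose_matrix_vector transpose_transpose)

text \<open>Parseval's identity. All coordinate computations below, in the basis \<open>V\<close> as
  well as in \<open>U\<close>, go through it.\<close>

lemma inner_columns_expansion:
  fixes V :: "real^'n^'n"
  assumes "orthogonal_matrix V"
  shows "x \<bullet> y = (\<Sum>i\<in>UNIV. (column i V \<bullet> x) * (column i V \<bullet> y))"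
  unfolding inner_transpose_orthogonal[OF assms, of x y, symmetric]
    inner_vec_def[of "transpose V *v x"] transpose_mult_vec_nth
  by simp

lemma norm_transpose_orthogonal:
  fixes V :: "real^'n^'n"
  assumes "orthogonal_matrix V"
  shows "norm (transpose V *v x) = norm x"
  by (simp add: norm_eq_sqrt_inner inner_transpose_orthogonal[OF assms])

lemma inner_columns_orthogonal:
  fixes V :: "real^'n^'n"
  assumes "orthogonal_matrix V"
  shows "column i V \<bullet> column j V = (if i = j then 1 else 0)"
proof -
  have "column i V \<bullet> column j V = (transpose V ** V) $ i $ j"
    by (simp add: matrix_matrix_mult_def transpose_def column_def inner_vec_def)
  then show ?thesis
    using assms by (simp add: orthogonal_matrix mat_def)
qed

lemma diag_matrix_mult_vec_nth: "(diag_matrix d *v x) $ i = d i * x $ i"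
proof -
  have "(if i = j then d i else 0) * x $ j = (if i = j then d i * x $ j else 0)" for j
    by simp
  then show ?thesis
    by (simp add: diag_matrix_def matrix_vector_mult_def)
qed

lemma transpose_mult_eigendecomposition:
  fixes A :: "real^'n^'n"
  assumes "eigendecomposition A V d"
  shows "transpose V *v (A *v x) = diag_matrix d *v (transpose V *v x)"
proof -
  have "transpose V ** A = (transpose V ** V) ** diag_matrix d ** transpose V"
    using assms by (simp add: eigendecomposition_def matrix_mul_assoc)
  also have "\<dots> = diag_matrix d ** transpose V"
    using assms by (simp add: eigendecomposition_def orthogonal_matrix)
  finally show ?thesis
    by (simp add: matrix_vector_mul_assoc)
qed

lemma column_inner_eigendecomposition:
  fixes A :: "real^'n^'n"
  assumes "eigendecomposition A V d"
  shows "column i V \<bullet> (A *v x) = d i * (column i V \<bullet> x)"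
  using arg_cong[OF transpose_mult_eigendecomposition[OF assms, of x], of "\<lambda>v. v $ i"]
  by (simp add: transpose_mult_vec_nth diag_matrix_mult_vec_nth)

text \<open>In the eigenbasis the matrix acts diagonally. The crude constant depends on the
  eigenvalues only, so for \<open>\<Phi> k\<close> it is the same for every choice of
  \<open>U\<close>.\<close>

lemma norm_eigendecomposition_le:
  fixes A :: "real^'n^'n"
  assumes "eigendecomposition A V d"
  shows "norm (A *v x) \<le> (\<Sum>i\<in>UNIV. \<bar>d i\<bar>) * norm x"
proof -
  let ?c = "\<Sum>i\<in>UNIV. \<bar>d i\<bar>"
  have V: "orthogonal_matrix V"
    using assms by (simp add: eigendecomposition_def)
  have "\<bar>d i\<bar> \<le> ?c" for i
    by (rule member_le_sum) auto
  then have "norm (diag_matrix d *v (transpose V *v x)) \<le> norm (?c *\<^sub>R (transpose V *v x))"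
    by (intro norm_le_componentwise_cart)
      (auto simp: diag_matrix_mult_vec_nth abs_mult sum_nonneg intro!: mult_right_mono)
  moreover have "norm (A *v x) = norm (diag_matrix d *v (transpose V *v x))"
    by (metis V norm_transpose_orthogonal transpose_mult_eigendecomposition[OF assms])
  ultimately show ?thesis
    by (simp add: norm_transpose_orthogonal[OF V] sum_nonneg)
qed

text \<open>Source of the factor \<open>sqrt n\<close>: by Parseval the squared norm is a sum of
  \<open>n\<close> squared coordinates.\<close>

lemma norm_le_sqrt_card_columns:
  fixes U :: "real^'n^'n"
  assumes "orthogonal_matrix U" and "\<And>i. \<bar>column i U \<bullet> y\<bar> \<le> B"
  shows "norm y \<le> sqrt (real CARD('n)) * B"
proof -
  have B: "0 \<le> B"
    using assms(2) abs_ge_zero order_trans by blast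
  have "(norm y)\<^sup>2 = (\<Sum>i\<in>UNIV. (column i U \<bullet> y)\<^sup>2)"
    unfolding power2_norm_eq_inner inner_columns_expansion[OF assms(1), of y y]
    by (simp add: power2_eq_square)
  also have "\<dots> \<le> (\<Sum>i\<in>(UNIV :: 'n set). B\<^sup>2)"
    using assms(2) by (intro sum_mono) (simp add: abs_le_square_iff[symmetric] B)
  also have "\<dots> = (sqrt (real CARD('n)) * B)\<^sup>2"
    by (simp add: power_mult_distrib)
  finally show ?thesis
    by (rule power2_le_imp_le) (simp add: B)
qed

section \<open>Overlaps between two misaligned orthonormal bases\<close>

lemma column_inner_of_expansion:
  fixes U :: "real^'n^'n"
  assumes "orthogonal_matrix U" and "v = (\<Sum>j\<in>UNIV. c j *\<^sub>R column j U)"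
  shows "column l U \<bullet> v = c l"
proof -
  have "column l U \<bullet> v = (\<Sum>j\<in>UNIV. if l = j then c j else 0)"
    unfolding assms(2) inner_sum_right
    by (rule sum.cong) (auto simp: inner_columns_orthogonal[OF assms(1)])
  then show ?thesis
    by simp
qed

text \<open>The coefficients in \<open>misaligned\<close> are the inner products of the basis
  vectors, so every overlap with \<open>j \<noteq> l\<close> is at most \<open>\<epsilon>\<close>.
  The one overlap left, \<open>j = l\<close>, is at most 1 by Cauchy-Schwarz for unit
  vectors.\<close>

lemma sum_abs_misaligned_le:
  fixes V U :: "real^'n^'n"
  assumes V: "orthogonal_matrix V" and U: "orthogonal_matrix U" and "0 \<le> \<epsilon>" and "misaligned \<epsilon> V U"
  shows "(\<Sum>j\<in>UNIV. \<bar>column j V \<bullet> column l U\<bar>) \<le> 1 + real CARD('n) * \<epsilon>"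
proof -
  obtain vh where vh: "\<And>i. column i V = (\<Sum>j\<in>UNIV. vh i j *\<^sub>R column j U)"
    and le: "\<And>i j. i \<noteq> j \<Longrightarrow> \<bar>vh i j\<bar> \<le> \<epsilon>"
    using assms(4) unfolding misaligned_def by blast
  have off: "\<bar>column j V \<bullet> column l U\<bar> \<le> \<epsilon>" if "j \<noteq> l" for j
    using column_inner_of_expansion[OF U vh, of l j] le[OF that] by (simp add: inner_commute)
  have "\<bar>column l V \<bullet> column l U\<bar> \<le> norm (column l V) * norm (column l U)"
    by (rule Cauchy_Schwarz_ineq2)
  also have "\<dots> = 1"
    by (simp add: norm_eq_sqrt_inner inner_columns_orthogonal[OF V] inner_columns_orthogonal[OF U])
  finally have diag: "\<bar>column l V \<bullet> column l U\<bar> \<le> 1" .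
  \<comment> \<open>The summand \<open>j = l\<close> also receives an \<open>\<epsilon>\<close>,
    whence \<open>n\<close> and not \<open>n - 1\<close> in the bound.\<close>
  have "(\<Sum>j\<in>UNIV. \<bar>column j V \<bullet> column l U\<bar>) \<le> (\<Sum>j\<in>UNIV. (if j = l then 1 else 0) + \<epsilon>)"
    using off diag \<open>0 \<le> \<epsilon>\<close> by (intro sum_mono) (auto intro: add_increasing2)
  then show ?thesis
    by (simp add: sum.distrib)
qed

section \<open>First-order expansion of matrix powers\<close>

lemma norm_mult_vec_le_spectral: "norm (A *v x) \<le> spectral_norm A * norm x"
  unfolding spectral_norm_def by (rule onorm) simp

lemma spectral_norm_nonneg: "0 \<le> spectral_norm A"
  unfolding spectral_norm_def by (rule onorm_pos_le) simp

lemma spectral_norm_leI: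
  assumes "\<And>x. norm (A *v x) \<le> b * norm x"
  shows "spectral_norm A \<le> b"
  unfolding spectral_norm_def by (rule onorm_le) (rule assms)

text \<open>The derivative of the \<open>k\<close>-th matrix power at \<open>A\<close> in direction
  \<open>P\<close>, that is, the sum of \<open>A^i P A^(k-1-i)\<close> over \<open>i < k\<close>.
  The recursion is the product rule.\<close>

primrec matrix_power_deriv :: "real^'n^'n \<Rightarrow> real^'n^'n \<Rightarrow> nat \<Rightarrow> real^'n^'n" where
  "matrix_power_deriv A P 0 = 0"
| "matrix_power_deriv A P (Suc k) = P ** matrix_power A k + A ** matrix_power_deriv A P k"

lemma norm_mult_vec_leI:
  assumes "spectral_norm A \<le> a" and "norm v \<le> b"
  shows "norm (A *v v) \<le> a * b"
  using norm_mult_vec_le_spectral[of A v] mult_mono[OF assms] spectral_norm_nonneg[of A] assms(1)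
  by fastforce

text \<open>The bound is fixed before \<open>P\<close>, as in the next two lemmas. This uniformity
  over a ball of perturbations is what keeps the final constant independent of
  \<open>E\<close>.\<close>

lemma matrix_power_perturbed_bound:
  fixes A :: "real^'n^'n"
  obtains B where "\<And>P. spectral_norm P \<le> r \<Longrightarrow> norm (matrix_power (A + P) k *v x) \<le> B"
proof -
  have "\<exists>B. \<forall>P. spectral_norm P \<le> r \<longrightarrow> norm (matrix_power (A + P) k *v x) \<le> B"
  proof (induction k)
    case 0
    show ?case by auto
  next
    case (Suc k)
    then obtain B where B: "\<And>P. spectral_norm P \<le> r \<Longrightarrow> norm (matrix_power (A + P) k *v x) \<le> B"
      by blast
    have "norm (matrix_power (A + P) (Suc k) *v x) \<le> spectral_norm A * B + r * B"
      if P: "spectral_norm P \<le> r" for P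
    proof -
      let ?y = "matrix_power (A + P) k *v x"
      have "matrix_power (A + P) (Suc k) *v x = A *v ?y + P *v ?y"
        by (simp add: matrix_vector_mul_assoc[symmetric] matrix_vector_mult_add_rdistrib)
      then show ?thesis
        using norm_triangle_mono[OF norm_mult_vec_leI[OF order_refl B[OF P]]
            norm_mult_vec_leI[OF P B[OF P]]]
        by metis
    qed
    then show ?case by blast
  qed
  then show ?thesis
    using that by blast
qed

text \<open>Each step of the induction splits the new difference into \<open>A\<close> applied to
  the old one and \<open>P\<close> applied to a uniformly bounded vector.\<close>

lemma matrix_power_diff_bound:
  fixes A :: "real^'n^'n"
  obtains B where "\<And>P. spectral_norm P \<le> r \<Longrightarrow>
    norm (matrix_power (A + P) k *v x - matrix_power A k *v x) \<le> B * spectral_norm P"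
proof -
  have "\<exists>B. \<forall>P. spectral_norm P \<le> r \<longrightarrow>
    norm (matrix_power (A + P) k *v x - matrix_power A k *v x) \<le> B * spectral_norm P"
  proof (induction k)
    case 0
    show ?case by (auto intro: exI[of _ 0])
  next
    case (Suc k)
    then obtain B where B: "\<And>P. spectral_norm P \<le> r \<Longrightarrow>
        norm (matrix_power (A + P) k *v x - matrix_power A k *v x) \<le> B * spectral_norm P"
      by blast
    obtain C where C: "\<And>P. spectral_norm P \<le> r \<Longrightarrow> norm (matrix_power (A + P) k *v x) \<le> C"
      using matrix_power_perturbed_bound by blast
    have "norm (matrix_power (A + P) (Suc k) *v x - matrix_power A (Suc k) *v x)
        \<le> (spectral_norm A * B + C) * spectral_norm P"
      if P: "spectral_norm P \<le> r" for P
    proof -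
      let ?y = "matrix_power (A + P) k *v x" and ?z = "matrix_power A k *v x"
      have eq: "matrix_power (A + P) (Suc k) *v x - matrix_power A (Suc k) *v x
          = A *v (?y - ?z) + P *v ?y"
        by (simp add: matrix_vector_mul_assoc[symmetric] matrix_vector_mult_add_rdistrib
            matrix_vector_mult_diff_distrib)
      show ?thesis
        unfolding eq
        using norm_triangle_mono[OF norm_mult_vec_leI[OF order_refl B[OF P], of A]
            norm_mult_vec_leI[OF order_refl C[OF P], of P]]
        by (simp add: algebra_simps)
    qed
    then show ?case by blast
  qed
  then show ?thesis
    using that by blast
qed

text \<open>The new remainder is \<open>A\<close> applied to the old one plus \<open>P\<close>
  applied to a difference that is already of first order in \<open>P\<close>, hence
  quadratic.\<close>

lemma matrix_power_remainder_bound: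
  fixes A :: "real^'n^'n"
  obtains B where "\<And>P. spectral_norm P \<le> r \<Longrightarrow>
    norm (matrix_power (A + P) k *v x - matrix_power A k *v x - matrix_power_deriv A P k *v x)
      \<le> B * (spectral_norm P)\<^sup>2"
proof -
  have "\<exists>B. \<forall>P. spectral_norm P \<le> r \<longrightarrow>
    norm (matrix_power (A + P) k *v x - matrix_power A k *v x - matrix_power_deriv A P k *v x)
      \<le> B * (spectral_norm P)\<^sup>2"
  proof (induction k)
    case 0
    show ?case by (auto intro: exI[of _ 0])
  next
    case (Suc k)
    then obtain B where B: "\<And>P. spectral_norm P \<le> r \<Longrightarrow>
        norm (matrix_power (A + P) k *v x - matrix_power A k *v x - matrix_power_deriv A P k *v x)
          \<le> B * (spectral_norm P)\<^sup>2"
      by blast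
    obtain C where C: "\<And>P. spectral_norm P \<le> r \<Longrightarrow>
        norm (matrix_power (A + P) k *v x - matrix_power A k *v x) \<le> C * spectral_norm P"
      using matrix_power_diff_bound by blast
    have "norm (matrix_power (A + P) (Suc k) *v x - matrix_power A (Suc k) *v x
          - matrix_power_deriv A P (Suc k) *v x)
        \<le> (spectral_norm A * B + C) * (spectral_norm P)\<^sup>2"
      if P: "spectral_norm P \<le> r" for P
    proof -
      let ?y = "matrix_power (A + P) k *v x" and ?z = "matrix_power A k *v x"
        and ?d = "matrix_power_deriv A P k *v x"
      have eq: "matrix_power (A + P) (Suc k) *v x - matrix_power A (Suc k) *v x
            - matrix_power_deriv A P (Suc k) *v x
          = A *v (?y - ?z - ?d) + P *v (?y - ?z)"
        by (simp add: matrix_vector_mul_assoc[symmetric] matrix_vector_mult_add_rdistrib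
            matrix_vector_mult_diff_distrib)
      show ?thesis
        unfolding eq
        using norm_triangle_mono[OF norm_mult_vec_leI[OF order_refl B[OF P], of A]
            norm_mult_vec_leI[OF order_refl C[OF P], of P]]
        by (simp add: algebra_simps power2_eq_square)
    qed
    then show ?case by blast
  qed
  then show ?thesis
    using that by blast
qed

lemma spectral_norm_relative_le:
  "spectral_norm (E ** S + S ** E) \<le> 2 * spectral_norm S * spectral_norm E"
proof (rule spectral_norm_leI)
  fix v
  have "norm (E *v (S *v v)) \<le> spectral_norm E * (spectral_norm S * norm v)"
    by (intro norm_mult_vec_leI norm_mult_vec_le_spectral order_refl)
  moreover have "norm (S *v (E *v v)) \<le> spectral_norm S * (spectral_norm E * norm v)"
    by (intro norm_mult_vec_leI norm_mult_vec_le_spectral order_refl)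
  ultimately show "norm ((E ** S + S ** E) *v v) \<le> 2 * spectral_norm S * spectral_norm E * norm v"
    using norm_triangle_ineq[of "E *v (S *v v)" "S *v (E *v v)"]
    by (simp add: matrix_vector_mul_assoc[symmetric] matrix_vector_mult_add_rdistrib algebra_simps)
qed

section \<open>Divided differences of the responses\<close>

text \<open>The quotient \<open>(a^k - b^k) / (a - b)\<close> as a polynomial, so that it also makes
  sense at \<open>a = b\<close>, with value \<open>k * a^(k-1)\<close>. The recursion has the shape
  of that of \<open>matrix_power_deriv\<close>, with \<open>a\<close> in the place of the right
  factor and \<open>b\<close> of the left one.\<close>

primrec power_divided_diff :: "real \<Rightarrow> real \<Rightarrow> nat \<Rightarrow> real" where
  "power_divided_diff a b 0 = 0"
| "power_divided_diff a b (Suc k) = a ^ k + b * power_divided_diff a b k"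

lemma power_divided_diff_mult: "(a - b) * power_divided_diff a b k = a ^ k - b ^ k"
proof (induction k)
  case (Suc k)
  have "(a - b) * power_divided_diff a b (Suc k)
      = (a - b) * a ^ k + b * ((a - b) * power_divided_diff a b k)"
    by (simp add: algebra_simps)
  also have "\<dots> = a ^ Suc k - b ^ Suc k"
    unfolding Suc by (simp add: algebra_simps)
  finally show ?case .
qed simp

lemma isCont_power_divided_diff: "isCont (\<lambda>b. power_divided_diff a b k) b"
  by (induction k) (auto intro!: continuous_intros)

definition response_divided_diff :: "nat \<Rightarrow> (nat \<Rightarrow> 'n \<Rightarrow> real) \<Rightarrow> 'n \<Rightarrow> real \<Rightarrow> real \<Rightarrow> real" where
  "response_divided_diff K \<phi> l a b = (\<Sum>k\<le>K. \<phi> k l * power_divided_diff a b k)"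

lemma response_divided_diff_mult:
  "(a - b) * response_divided_diff K \<phi> l a b = es_response K \<phi> l a - es_response K \<phi> l b"
proof -
  have "(a - b) * response_divided_diff K \<phi> l a b
      = (\<Sum>k\<le>K. \<phi> k l * ((a - b) * power_divided_diff a b k))"
    unfolding response_divided_diff_def sum_distrib_left by (rule sum.cong) simp_all
  then show ?thesis
    by (simp add: power_divided_diff_mult es_response_def right_diff_distrib sum_subtractf)
qed

text \<open>Off the diagonal this is the integral Lipschitz condition multiplied by 2. On the
  diagonal it follows by letting the second argument tend to \<open>a\<close> within
  \<open>D\<close>, the divided difference being a continuous polynomial.\<close>

lemma response_divided_diff_le:
  assumes D: "is_interval D" "interior D \<noteq> {}"
    and lip: "integral_lipschitz_on D C (es_response K \<phi> l)"
    and ab: "a \<in> D" "b \<in> D"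
  shows "\<bar>(a + b) * response_divided_diff K \<phi> l a b\<bar> \<le> 2 * C"
proof -
  have neq: "\<bar>(a + c) * response_divided_diff K \<phi> l a c\<bar> \<le> 2 * C" if "c \<in> D" "c \<noteq> a" for c
  proof -
    have "response_divided_diff K \<phi> l a c
        = (es_response K \<phi> l a - es_response K \<phi> l c) / (a - c)"
      using that(2) by (simp add: response_divided_diff_mult[symmetric])
    then have "\<bar>(a + c) / 2 * response_divided_diff K \<phi> l a c\<bar> \<le> C"
      using lip[unfolded integral_lipschitz_on_def, rule_format, OF ab(1) that(1) that(2)[symmetric]]
      by metis
    moreover have "(a + c) * response_divided_diff K \<phi> l a c
        = 2 * ((a + c) / 2 * response_divided_diff K \<phi> l a c)"
      by simp
    ultimately show ?thesis
      by linarith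
  qed
  show ?thesis
  proof (cases "a = b")
    case False
    then show ?thesis
      using neq ab(2) by blast
  next
    case True
    let ?g = "\<lambda>c. \<bar>(a + c) * response_divided_diff K \<phi> l a c\<bar>"
    \<comment> \<open>A connected set with more than one point has no isolated points, so the limit
      within \<open>D\<close> is not vacuous.\<close>
    have "D \<noteq> {a}"
      using D(2) by auto
    then have "a islimpt D"
      using D(1) ab(1) connected_imp_perfect is_interval_connected by blast
    then have nontriv: "at a within D \<noteq> bot"
      by (simp add: trivial_limit_within)
    have "isCont ?g a"
      unfolding response_divided_diff_def
      by (intro continuous_intros isCont_power_divided_diff)
    then have "(?g \<longlongrightarrow> ?g a) (at a within D)"
      using continuous_at_imp_continuous_at_within continuous_within by blast
    moreover have "\<forall>\<^sub>F c in at a within D. ?g c \<le> 2 * C"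
      using neq by (simp add: eventually_at_filter)
    ultimately show ?thesis
      using tendsto_upperbound[OF _ _ nontriv] True by blast
  qed
qed

section \<open>The first-order term\<close>

lemma column_inner_matrix_power:
  fixes S :: "real^'n^'n"
  assumes "eigendecomposition S V \<Lambda>"
  shows "column i V \<bullet> (matrix_power S k *v x) = \<Lambda> i ^ k * (column i V \<bullet> x)"
  by (induction k)
    (simp_all add: matrix_vector_mul_assoc[symmetric] column_inner_eigendecomposition[OF assms])

text \<open>Symmetry moves \<open>E\<close> onto the column of \<open>V\<close>, so that later only
  the norm of \<open>E *v column j V\<close> has to be bounded.\<close>

lemma column_inner_symmetric_mult:
  fixes E V :: "real^'n^'n"
  assumes V: "orthogonal_matrix V" and "transpose E = E"
  shows "column j V \<bullet> (E *v y) = (\<Sum>i\<in>UNIV. (column i V \<bullet> (E *v column j V)) * (column i V \<bullet> y))"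
proof -
  have "column j V \<bullet> (E *v y) = (E *v column j V) \<bullet> y"
    by (metis assms(2) dot_lmul_matrix transpose_matrix_vector)
  then show ?thesis
    by (simp only: inner_columns_expansion[OF V, of "E *v column j V" y])
qed

text \<open>A Daletskii-Krein formula: in the eigenbasis of \<open>S\<close>, the derivative
  multiplies each entry of the direction by a divided difference. The direction
  \<open>E ** S + S ** E\<close> has the entries of \<open>E\<close> times
  \<open>\<Lambda> i + \<Lambda> j\<close>, which is the factor that the integral Lipschitz
  condition needs.\<close>

lemma column_inner_matrix_power_deriv:
  fixes S E :: "real^'n^'n"
  assumes S: "eigendecomposition S V \<Lambda>" and E: "transpose E = E"
  shows "column j V \<bullet> (matrix_power_deriv S (E ** S + S ** E) k *v x)
    = (\<Sum>i\<in>UNIV. (column i V \<bullet> (E *v column j V)) * (column i V \<bullet> x)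
        * ((\<Lambda> i + \<Lambda> j) * power_divided_diff (\<Lambda> i) (\<Lambda> j) k))"
proof (induction k)
  case 0
  show ?case by simp
next
  case (Suc k)
  have V: "orthogonal_matrix V"
    using S by (simp add: eigendecomposition_def)
  let ?y = "matrix_power S k *v x"
  note expand = column_inner_symmetric_mult[OF V E, of j ?y]
    column_inner_symmetric_mult[OF V E, of j "S *v ?y"]
    column_inner_eigendecomposition[OF S] column_inner_matrix_power[OF S]
  have "column j V \<bullet> (matrix_power_deriv S (E ** S + S ** E) (Suc k) *v x)
    = column j V \<bullet> (E *v (S *v ?y)) + column j V \<bullet> (S *v (E *v ?y))
      + column j V \<bullet> (S *v (matrix_power_deriv S (E ** S + S ** E) k *v x))"
    by (simp add: matrix_vector_mul_assoc[symmetric] matrix_vector_mult_add_rdistrib inner_add_right)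
  also have "\<dots> = (\<Sum>i\<in>UNIV. (column i V \<bullet> (E *v column j V)) * (column i V \<bullet> x)
        * ((\<Lambda> i + \<Lambda> j) * power_divided_diff (\<Lambda> i) (\<Lambda> j) (Suc k)))"
    unfolding expand Suc sum_distrib_left
      sum.distrib[symmetric]
    by (rule sum.cong) (simp_all add: algebra_simps)
  finally show ?case .
qed

lemma norm_first_order_le:
  fixes S E :: "real^'n^'n"
  assumes S: "eigendecomposition S V \<Lambda>"
    and \<Phi>: "\<And>k. k \<le> K \<Longrightarrow> eigendecomposition (\<Phi> k) U (\<phi> k)"
    and U: "orthogonal_matrix U"
    and D: "frequency_domain D \<Lambda>"
    and lip: "\<And>i. integral_lipschitz_on D C (es_response K \<phi> i)"
    and mis: "0 \<le> \<epsilon>" "misaligned \<epsilon> V U"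
    and E: "transpose E = E" "spectral_norm E \<le> \<eta>"
  shows "norm (\<Sum>k\<le>K. \<Phi> k *v (matrix_power_deriv S (E ** S + S ** E) k *v x))
    \<le> 2 * sqrt (real CARD('n)) * (1 + real CARD('n) * \<epsilon>) * C * norm x * \<eta>"
    (is "norm ?F \<le> _")
proof -
  have V: "orthogonal_matrix V"
    using S by (simp add: eigendecomposition_def)
  have \<Lambda>: "\<Lambda> i \<in> D" for i
    using D by (auto simp: frequency_domain_def)
  have g: "\<bar>(\<Lambda> i + \<Lambda> j) * response_divided_diff K \<phi> l (\<Lambda> i) (\<Lambda> j)\<bar> \<le> 2 * C" for i j l
    using D lip \<Lambda> by (intro response_divided_diff_le) (auto simp: frequency_domain_def)
  have C: "0 \<le> 2 * C"
    using g abs_ge_zero order_trans by blast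
  \<comment> \<open>The coordinate along \<open>column j V\<close> of the first-order term, with the
    eigenvalues \<open>\<phi> k l\<close> in the place of the matrices
    \<open>\<Phi> k\<close>.\<close>
  define w where "w l j = (\<Sum>i\<in>UNIV. (column i V \<bullet> (E *v column j V)) * (column i V \<bullet> x)
      * ((\<Lambda> i + \<Lambda> j) * response_divided_diff K \<phi> l (\<Lambda> i) (\<Lambda> j)))" for l j
  have w_le: "\<bar>w l j\<bar> \<le> 2 * C * norm x * \<eta>" for l j
  proof -
    let ?e = "transpose V *v (E *v column j V)" and ?x = "transpose V *v x"
    have "\<bar>w l j\<bar> \<le> (\<Sum>i\<in>UNIV. \<bar>?e $ i * ?x $ i\<bar> * (2 * C))"
      unfolding w_def transpose_mult_vec_nth
      by (intro order_trans[OF sum_abs] sum_mono)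
        (subst abs_mult, intro mult_left_mono g abs_ge_zero)
    also have "\<dots> = (\<Sum>i\<in>UNIV. \<bar>?e $ i\<bar> * \<bar>?x $ i\<bar>) * (2 * C)"
      by (simp add: sum_distrib_right abs_mult)
    \<comment> \<open>Cauchy-Schwarz over \<open>i\<close> uses the norm of the whole row of
      \<open>E\<close>; bounding its entries one by one would cost a further power of
      \<open>n\<close>.\<close>
    also have "\<dots> \<le> (L2_set (($) ?e) UNIV * L2_set (($) ?x) UNIV) * (2 * C)"
      by (intro mult_right_mono L2_set_mult_ineq C)
    also have "\<dots> = norm (E *v column j V) * norm x * (2 * C)"
      using norm_transpose_orthogonal[OF V, of "E *v column j V"] norm_transpose_orthogonal[OF V, of x]
      by (simp add: norm_vec_def L2_set_def)
    also have "\<dots> \<le> \<eta> * norm x * (2 * C)"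
    proof (intro mult_right_mono C norm_ge_zero)
      have "norm (column j V) = 1"
        by (simp add: norm_eq_sqrt_inner inner_columns_orthogonal[OF V])
      then show "norm (E *v column j V) \<le> \<eta>"
        using norm_mult_vec_le_spectral[of E "column j V"] E(2) by simp
    qed
    finally show ?thesis
      by (simp add: mult_ac)
  qed
  have "\<bar>column l U \<bullet> ?F\<bar> \<le> (1 + real CARD('n) * \<epsilon>) * (2 * C * norm x * \<eta>)" for l
  proof -
    let ?L = "\<lambda>k. matrix_power_deriv S (E ** S + S ** E) k *v x"
    \<comment> \<open>Summing over \<open>k\<close> first is essential: the Lipschitz condition
      controls the whole response, not its monomials.\<close>
    have w_eq: "(\<Sum>k\<le>K. \<phi> k l * (column j V \<bullet> ?L k)) = w l j" for j
      unfolding w_def column_inner_matrix_power_deriv[OF S E(1)] response_divided_diff_def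
        sum_distrib_left
      by (subst sum.swap) (simp add: mult_ac)
    have "column l U \<bullet> ?F = (\<Sum>k\<le>K. \<phi> k l * (column l U \<bullet> ?L k))"
      unfolding inner_sum_right
      by (rule sum.cong) (auto simp: column_inner_eigendecomposition[OF \<Phi>])
    also have "\<dots> = (\<Sum>k\<le>K. \<phi> k l * (\<Sum>j\<in>UNIV. (column j V \<bullet> column l U) * (column j V \<bullet> ?L k)))"
      by (simp only: inner_columns_expansion[OF V, of "column l U" "?L _"])
    also have "\<dots> = (\<Sum>j\<in>UNIV. (column j V \<bullet> column l U) * (\<Sum>k\<le>K. \<phi> k l * (column j V \<bullet> ?L k)))"
      unfolding sum_distrib_left by (subst sum.swap) (simp add: mult_ac)
    also have "\<dots> = (\<Sum>j\<in>UNIV. (column j V \<bullet> column l U) * w l j)"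
      by (simp only: w_eq)
    finally have "\<bar>column l U \<bullet> ?F\<bar> \<le> (\<Sum>j\<in>UNIV. \<bar>column j V \<bullet> column l U\<bar> * \<bar>w l j\<bar>)"
      by (metis (no_types, lifting) abs_mult sum.cong sum_abs)
    also have "\<dots> \<le> (\<Sum>j\<in>UNIV. \<bar>column j V \<bullet> column l U\<bar>) * (2 * C * norm x * \<eta>)"
      unfolding sum_distrib_right by (intro sum_mono mult_left_mono w_le abs_ge_zero)
    also have "\<dots> \<le> (1 + real CARD('n) * \<epsilon>) * (2 * C * norm x * \<eta>)"
      using order_trans[OF abs_ge_zero w_le]
      by (intro mult_right_mono sum_abs_misaligned_le[OF V U mis])
    finally show ?thesis .
  qed
  then have "norm ?F \<le> sqrt (real CARD('n)) * ((1 + real CARD('n) * \<epsilon>) * (2 * C * norm x * \<eta>))"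
    by (rule norm_le_sqrt_card_columns[OF U])
  also have "\<dots> = 2 * sqrt (real CARD('n)) * (1 + real CARD('n) * \<epsilon>) * C * norm x * \<eta>"
    by (simp add: algebra_simps)
  finally show ?thesis .
qed

text \<open>The filter difference splits into the first-order term, bounded by
  \<open>norm_first_order_le\<close>, and a quadratic remainder. \<open>M\<close> and
  \<open>\<delta>\<close> are chosen before the bases, the matrices \<open>\<Phi> k\<close>, the
  constants and \<open>E\<close>.\<close>

theorem theorem2:
  fixes \<E> :: "('n::finite \<times> 'n) set" and S :: "real^'n^'n"
    and K :: nat and \<phi> :: "nat \<Rightarrow> 'n \<Rightarrow> real" and x :: "real^'n"
  assumes "graph_shift_operator \<E> S"
  shows "\<exists>M \<delta> :: real. \<delta> > 0 \<and>
    (\<forall>(V :: real^'n^'n) (\<Lambda> :: 'n \<Rightarrow> real) (U :: real^'n^'n) (\<Phi> :: nat \<Rightarrow> real^'n^'n)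
      (D :: real set) (C\<^sub>L :: real) (\<epsilon> :: real).
       eigendecomposition S V \<Lambda> \<and>
       es_edge_parameters S K U \<phi> \<Phi> \<and>
       frequency_domain D \<Lambda> \<and>
       C\<^sub>L > 0 \<and>
       (\<forall>i. integral_lipschitz_on D C\<^sub>L (es_response K \<phi> i)) \<and>
       (\<forall>i. \<forall>\<mu>\<in>D. \<bar>es_response K \<phi> i \<mu>\<bar> \<le> 1) \<and>
       \<epsilon> \<ge> 0 \<and> misaligned \<epsilon> V U
       \<longrightarrow>
       (\<forall>(\<eta> :: real) (E :: real^'n^'n).
          0 \<le> \<eta> \<and> \<eta> < \<delta> \<and> transpose E = E \<and> spectral_norm E \<le> \<eta>
          \<longrightarrow>
          norm (es_filter K \<Phi> x S - es_filter K \<Phi> x (relative_perturbation S E))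
            \<le> 2 * sqrt (real CARD('n)) * (1 + real CARD('n) * \<epsilon>) * C\<^sub>L * norm x * \<eta>
               + M * \<eta>\<^sup>2))"
proof -
  define a where "a = spectral_norm S"
  have a: "0 \<le> a"
    by (simp add: a_def spectral_norm_nonneg)
  \<comment> \<open>The radius \<open>2 * a\<close> suffices because \<open>E ** S + S ** E\<close>
    has spectral norm at most \<open>2 * a * \<eta>\<close>, and \<open>\<eta> < 1\<close>.\<close>
  have "\<forall>k. \<exists>B. \<forall>P. spectral_norm P \<le> 2 * a \<longrightarrow>
      norm (matrix_power (S + P) k *v x - matrix_power S k *v x - matrix_power_deriv S P k *v x)
        \<le> B * (spectral_norm P)\<^sup>2"
    using matrix_power_remainder_bound[of "2 * a" S _ x] by metis
  then obtain B where B: "\<And>k P. spectral_norm P \<le> 2 * a \<Longrightarrow>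
      norm (matrix_power (S + P) k *v x - matrix_power S k *v x - matrix_power_deriv S P k *v x)
        \<le> B k * (spectral_norm P)\<^sup>2"
    by metis
  define c where "c k = (\<Sum>i\<in>UNIV. \<bar>\<phi> k i\<bar>)" for k
  have c: "0 \<le> c k" for k
    by (simp add: c_def sum_nonneg)
  \<comment> \<open>\<open>c k\<close> bounds the action of \<open>\<Phi> k\<close>, and the square
    comes from the bound \<open>2 * a * \<eta>\<close> on the direction. The absolute value is there
    because the sign of \<open>B k\<close> is not known.\<close>
  define M where "M = (\<Sum>k\<le>K. c k * (\<bar>B k\<bar> * (2 * a)\<^sup>2))"
  have main: "norm (es_filter K \<Phi> x S - es_filter K \<Phi> x (relative_perturbation S E))
      \<le> 2 * sqrt (real CARD('n)) * (1 + real CARD('n) * \<epsilon>) * C * norm x * \<eta> + M * \<eta>\<^sup>2"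
    if S: "eigendecomposition S V \<Lambda>" and par: "es_edge_parameters S K U \<phi> \<Phi>"
      and D: "frequency_domain D \<Lambda>"
      and lip: "\<forall>i. integral_lipschitz_on D C (es_response K \<phi> i)"
      and mis: "0 \<le> \<epsilon>" "misaligned \<epsilon> V U"
      and \<eta>: "0 \<le> \<eta>" "\<eta> < 1" and E: "transpose E = E" "spectral_norm E \<le> \<eta>"
    for V \<Lambda> U \<Phi> D C \<epsilon> \<eta> E
  proof -
    have \<Phi>: "eigendecomposition (\<Phi> k) U (\<phi> k)" if "k \<le> K" for k
      using par that by (auto simp: es_edge_parameters_def)
    then have U: "orthogonal_matrix U"
      using eigendecomposition_def by blast
    define P where "P = E ** S + S ** E"
    let ?L = "\<lambda>k. matrix_power_deriv S P k *v x"
    let ?R = "\<lambda>k. matrix_power (S + P) k *v x - matrix_power S k *v x - ?L k"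
    have P: "spectral_norm P \<le> 2 * a * \<eta>"
      using spectral_norm_relative_le[of E S] mult_left_mono[OF E(2), of "2 * a"] a
      by (simp add: P_def a_def)
    also have "\<dots> \<le> 2 * a"
      using \<eta> a by (simp add: mult_left_le)
    finally have P': "spectral_norm P \<le> 2 * a" .
    have R: "norm (\<Phi> k *v ?R k) \<le> c k * (\<bar>B k\<bar> * (2 * a)\<^sup>2) * \<eta>\<^sup>2" if "k \<le> K" for k
    proof -
      have "norm (?R k) \<le> \<bar>B k\<bar> * (spectral_norm P)\<^sup>2"
        using B[OF P'] mult_right_mono[OF abs_ge_self, of "(spectral_norm P)\<^sup>2" "B k"]
        by (meson order_trans zero_le_power2)
      also have "\<dots> \<le> \<bar>B k\<bar> * (2 * a * \<eta>)\<^sup>2"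
        by (intro mult_left_mono power_mono P spectral_norm_nonneg abs_ge_zero)
      finally have "c k * norm (?R k) \<le> c k * (\<bar>B k\<bar> * (2 * a * \<eta>)\<^sup>2)"
        by (intro mult_left_mono c)
      then show ?thesis
        using norm_eigendecomposition_le[OF \<Phi>[OF that], of "?R k"]
        by (simp add: c_def power_mult_distrib mult_ac)
    qed
    have diff: "(\<Phi> k ** matrix_power S k) *v x - (\<Phi> k ** matrix_power (S + P) k) *v x
        = - (\<Phi> k *v ?L k + \<Phi> k *v ?R k)" for k
      by (simp add: matrix_vector_mul_assoc[symmetric] matrix_vector_mult_diff_distrib)
    have "es_filter K \<Phi> x S - es_filter K \<Phi> x (relative_perturbation S E)
        = - ((\<Sum>k\<le>K. \<Phi> k *v ?L k) + (\<Sum>k\<le>K. \<Phi> k *v ?R k))"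
      unfolding es_filter_def relative_perturbation_def add.assoc P_def[symmetric]
      by (simp only: sum_subtractf[symmetric] diff sum_negf sum.distrib)
    then have "norm (es_filter K \<Phi> x S - es_filter K \<Phi> x (relative_perturbation S E))
        \<le> norm (\<Sum>k\<le>K. \<Phi> k *v ?L k) + norm (\<Sum>k\<le>K. \<Phi> k *v ?R k)"
      by (simp only: norm_minus_cancel norm_triangle_ineq)
    moreover have "norm (\<Sum>k\<le>K. \<Phi> k *v ?R k) \<le> M * \<eta>\<^sup>2"
      unfolding M_def sum_distrib_right using R by (intro sum_norm_le) auto
    moreover have "norm (\<Sum>k\<le>K. \<Phi> k *v ?L k)
        \<le> 2 * sqrt (real CARD('n)) * (1 + real CARD('n) * \<epsilon>) * C * norm x * \<eta>"
      unfolding P_def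
      by (rule norm_first_order_le[where K = K and \<Phi> = \<Phi> and \<phi> = \<phi>, OF S \<Phi> U D _ mis E])
        (use lip in auto)
    ultimately show ?thesis
      by linarith
  qed
  show ?thesis
    \<comment> \<open>\<open>\<delta> = 1\<close> is the bound on \<open>\<eta>\<close> that keeps
      the perturbation in the ball of radius \<open>2 * a\<close>.\<close>
    by (rule exI[of _ M], rule exI[of _ 1]) (use main in auto)
qed

end
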